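(* Fix an integer $d\ge 1$ and a prime power $q$, and suppose that $\mathrm{Mat}_d(\mathbb{Z})$ contains an exceptional clique of size $q$. Then there exist infinitely many integers $n\ge 0$ such that $\mathrm{Mat}_n(\mathbb{Z})$ contains an exceptional clique of size $\delta_{d,q}\cdot n\log n+O(n\log\log n)$ (where the implied constant may depend on $d$ and $q$ but not on $n$), where $$\delta_{d,q}=\frac{q}{d\log q}\cdot\prod_{i=0}^{\infty}\Big(1+\frac{\varepsilon_q}{q^{2^i}}\Big)^{-1}\quad\text{and}\quad \varepsilon_q=\begin{cases}2&\text{if } q \text{ is even}\\ 1&\text{if } q\text{ is odd.}\end{cases}$$
   Context: $\mathrm{Mat}_n(\mathbb{Z})$ is the ring of $n\times n$ integer matrices. An exceptional clique in a unital ring $R$ is a subset $C\subseteq R$ such that $u-v$ is a unit of $R$ for all distinct $u,v\in C$. $\log$ is the natural logarithm. *)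

theory Defs
  imports
    "HOL-Analysis.Infinite_Products"
    "HOL-Library.Landau_Symbols"
    "HOL-Number_Theory.Prime_Powers"
    "Jordan_Normal_Form.Matrix"
begin

definition exceptional_clique :: "('a, 'b) ring_scheme \<Rightarrow> 'a set \<Rightarrow> bool" where
  "exceptional_clique R C \<longleftrightarrow>
     C \<subseteq> carrier R \<and> (\<forall>u\<in>C. \<forall>v\<in>C. u \<noteq> v \<longrightarrow> u \<ominus>\<^bsub>R\<^esub> v \<in> Units R)"

definition has_exceptional_clique_of_size :: "('a, 'b) ring_scheme \<Rightarrow> nat \<Rightarrow> bool" where
  "has_exceptional_clique_of_size R m \<longleftrightarrow>
     (\<exists>C. exceptional_clique R C \<and> finite C \<and> card C = m)"

abbreviation int_mat_ring :: "nat \<Rightarrow> int mat ring" where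
  "int_mat_ring n \<equiv> ring_mat TYPE(int) n ()"

definition eps :: "nat \<Rightarrow> real" where
  "eps q = (if even q then 2 else 1)"

definition clique_const :: "nat \<Rightarrow> nat \<Rightarrow> real" where
  "clique_const d q =
     real q / (real d * ln (real q)) * (\<Prod>i. inverse (1 + eps q / real q ^ (2 ^ i)))"

end

(*
  A clique C of prime power size Q in Mat_n(Z) yields one of size Q^2 in Mat_(n m)(Z), m = floor(Q/2) + 1:
  label the lines of each of the Q + 1 parallel classes of the affine plane of order Q by the elements of C.
  Two distinct points lie on a common line of exactly one class, so the difference of their label tuples
  has one zero entry and Q units. Placing the tuple on the diagonal and the cyclic superdiagonal of an
  m x m block matrix, the difference of two such matrices is invertible, because the zero entry breaks
  the cycle and the linear system becomes triangular.

  Iterating i times from (d, q) gives a clique of size Q = q^(2^i) in dimension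
  n = (d/q) * (Q/2^i) * prod_(j<i) (1 + eps_q / q^(2^j)). The partial products increase to their limit
  and ln n <= ln Q = 2^i ln q for large i, hence Q >= delta * n ln n.
*)

theory Submission
  imports Defs "Jordan_Normal_Form.Char_Poly" "HOL-Real_Asymp.Real_Asymp"
begin

section \<open>Ideals and maximal ideals of commutative rings\<close>

definition is_ideal :: "'a::comm_ring_1 set \<Rightarrow> bool" where
  "is_ideal J \<longleftrightarrow> 0 \<in> J \<and> (\<forall>a\<in>J. \<forall>b\<in>J. a + b \<in> J) \<and> (\<forall>r. \<forall>a\<in>J. r * a \<in> J)"

lemma is_idealD:
  assumes "is_ideal J"
  shows "0 \<in> J" "a \<in> J \<Longrightarrow> b \<in> J \<Longrightarrow> a + b \<in> J" "a \<in> J \<Longrightarrow> r * a \<in> J" "a \<in> J \<Longrightarrow> a * r \<in> J"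
    "a \<in> J \<Longrightarrow> - a \<in> J" "a \<in> J \<Longrightarrow> b \<in> J \<Longrightarrow> a - b \<in> J"
proof -
  show 1: "0 \<in> J" "a \<in> J \<Longrightarrow> b \<in> J \<Longrightarrow> a + b \<in> J" "a \<in> J \<Longrightarrow> r * a \<in> J" for a b r
    using assms unfolding is_ideal_def by auto
  show "a \<in> J \<Longrightarrow> a * r \<in> J" using 1(3)[of a r] by (simp add: mult.commute)
  show 2: "a \<in> J \<Longrightarrow> - a \<in> J" for a using 1(3)[of a "-1"] by simp
  show "a \<in> J \<Longrightarrow> b \<in> J \<Longrightarrow> a - b \<in> J" using 1(2)[of a "-b"] 2[of b] by simp
qed

lemma is_ideal_sum:
  assumes "is_ideal J" "\<And>i. i \<in> A \<Longrightarrow> f i \<in> J"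
  shows "sum f A \<in> J"
  using assms(2) by (induction A rule: infinite_finite_induct) (auto intro: is_idealD[OF assms(1)])

text \<open>Zorn's lemma on the ideals containing \<open>I\<close> but not 1. If \<open>a\<close>
  had no inverse modulo a maximal \<open>M\<close>, then the ideal generated by \<open>M\<close> and
  \<open>a\<close> would be strictly larger and still proper. The last conjunct says that the
  quotient is a field without forming it.\<close>

lemma ex_maximal_ideal:
  fixes I :: "'a::comm_ring_1 set"
  assumes I: "is_ideal I" "1 \<notin> I"
  shows "\<exists>M. is_ideal M \<and> I \<subseteq> M \<and> 1 \<notin> M \<and> (\<forall>a. a \<notin> M \<longrightarrow> (\<exists>b. 1 - a * b \<in> M))"
proof -
  define S where "S = {J. is_ideal J \<and> I \<subseteq> J \<and> 1 \<notin> J}"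
  have "\<exists>M\<in>S. \<forall>X\<in>S. M \<subseteq> X \<longrightarrow> X = M"
  proof (rule subset_Zorn_nonempty)
    show "S \<noteq> {}" using I by (auto simp: S_def)
    fix C assume C: "C \<noteq> {}" "subset.chain S C"
    hence CS: "C \<subseteq> S" and lin: "\<And>X Y. X \<in> C \<Longrightarrow> Y \<in> C \<Longrightarrow> X \<subseteq> Y \<or> Y \<subseteq> X"
      by (auto simp: subset.chain_def subset_chain_def)
    have id: "is_ideal X" if "X \<in> C" for X using CS that by (auto simp: S_def)
    have "is_ideal (\<Union>C)"
      unfolding is_ideal_def
    proof (intro conjI ballI allI)
      show "0 \<in> \<Union>C" using C(1) id is_idealD(1) by blast
    next
      fix a b assume "a \<in> \<Union>C" "b \<in> \<Union>C"
      then obtain X Y where XY: "X \<in> C" "Y \<in> C" "a \<in> X" "b \<in> Y" by blast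
      then obtain Z where "Z \<in> C" "a \<in> Z" "b \<in> Z" using lin by blast
      thus "a + b \<in> \<Union>C" using id is_idealD(2) by blast
    next
      fix r a assume "a \<in> \<Union>C"
      thus "r * a \<in> \<Union>C" using id is_idealD(3) by blast
    qed
    moreover have "I \<subseteq> \<Union>C" "1 \<notin> \<Union>C" using C(1) CS by (auto simp: S_def)
    ultimately show "\<Union>C \<in> S" by (simp add: S_def)
  qed
  then obtain M where M: "M \<in> S" and mx: "\<And>X. X \<in> S \<Longrightarrow> M \<subseteq> X \<Longrightarrow> X = M" by blast
  have Mi: "is_ideal M" using M by (simp add: S_def)
  have "\<exists>b. 1 - a * b \<in> M" if a: "a \<notin> M" for a
  proof (rule ccontr)
    assume no: "\<not> (\<exists>b. 1 - a * b \<in> M)"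
    define X where "X = {m + a * b | m b. m \<in> M}"
    have MX: "M \<subseteq> X"
    proof
      fix m assume "m \<in> M"
      thus "m \<in> X" unfolding X_def by (intro CollectI exI[of _ m] exI[of _ 0]) simp
    qed
    have aX: "a \<in> X" unfolding X_def
      by (intro CollectI exI[of _ 0] exI[of _ 1]) (simp add: is_idealD(1)[OF Mi])
    have "1 \<notin> X"
    proof
      assume "1 \<in> X"
      then obtain m b where "1 = m + a * b" "m \<in> M" by (auto simp: X_def)
      moreover from this have "1 - a * b = m" by (metis add_diff_cancel_right')
      ultimately have "1 - a * b \<in> M" by simp
      thus False using no by blast
    qed
    moreover have "is_ideal X" unfolding is_ideal_def
    proof (intro conjI ballI allI)
      show "0 \<in> X" using MX is_idealD(1)[OF Mi] by blast
    next
      fix x y assume "x \<in> X" "y \<in> X"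
      then obtain m b m' b' where "x = m + a * b" "y = m' + a * b'" "m \<in> M" "m' \<in> M"
        by (auto simp: X_def)
      thus "x + y \<in> X" unfolding X_def
        by (intro CollectI exI[of _ "m + m'"] exI[of _ "b + b'"])
          (auto simp: algebra_simps intro: is_idealD[OF Mi])
    next
      fix r x assume "x \<in> X"
      then obtain m b where "x = m + a * b" "m \<in> M" by (auto simp: X_def)
      thus "r * x \<in> X" unfolding X_def
        by (intro CollectI exI[of _ "r * m"] exI[of _ "r * b"])
          (auto simp: algebra_simps intro: is_idealD[OF Mi])
    qed
    ultimately have "X \<in> S" using MX M by (auto simp: S_def)
    with mx MX aX a show False by blast
  qed
  with M show ?thesis by (auto simp: S_def)
qed

section \<open>Frobenius congruences modulo a prime\<close>

lemma dvd_diff_power: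
  fixes a b c :: "'a::comm_ring_1"
  assumes "c dvd a - b"
  shows "c dvd a ^ n - b ^ n"
  using assms by (simp add: power_diff_sumr2)

text \<open>All binomial coefficients except the two outer ones are divisible by
  \<open>p\<close>.\<close>

lemma prime_dvd_power_add:
  fixes a b :: "'a::comm_ring_1"
  assumes p: "prime p"
  shows "of_nat p dvd (a + b) ^ p - (a ^ p + b ^ p)"
proof -
  have p1: "p \<ge> 1" using p prime_ge_1_nat by blast
  define h where "h k = of_nat (p choose k) * a ^ k * b ^ (p - k)" for k
  have "(a + b) ^ p = (\<Sum>k\<le>p. h k)" by (simp add: binomial_ring h_def)
  also have "{..p} = insert 0 (insert p {1..<p})" using p1 by auto
  also have "(\<Sum>k\<in>\<dots>. h k) = b ^ p + (a ^ p + (\<Sum>k\<in>{1..<p}. h k))"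
    using p1 by (simp add: h_def)
  finally have "(a + b) ^ p - (a ^ p + b ^ p) = (\<Sum>k\<in>{1..<p}. h k)" by simp
  moreover have "of_nat p dvd h k" if "k \<in> {1..<p}" for k
  proof -
    have "p dvd p choose k" using that p by (intro dvd_choose_prime) auto
    hence "(of_nat p :: 'a) dvd of_nat (p choose k)" by (auto elim!: dvdE)
    thus ?thesis by (simp add: h_def)
  qed
  ultimately show ?thesis by (simp only: dvd_sum)
qed

text \<open>Congruences modulo \<open>p\<close> survive taking \<open>p\<close>-th powers, so the
  case of exponent \<open>p\<close> iterates.\<close>

lemma prime_dvd_prime_power_add:
  fixes a b :: "'a::comm_ring_1"
  assumes p: "prime p"
  shows "of_nat p dvd (a + b) ^ (p ^ k) - (a ^ (p ^ k) + b ^ (p ^ k))"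
proof (induction k)
  case (Suc k)
  have "of_nat p dvd ((a + b) ^ (p ^ k)) ^ p - (a ^ (p ^ k) + b ^ (p ^ k)) ^ p"
    by (rule dvd_diff_power[OF Suc])
  moreover have "of_nat p dvd (a ^ (p ^ k) + b ^ (p ^ k)) ^ p - ((a ^ (p ^ k)) ^ p + (b ^ (p ^ k)) ^ p)"
    by (rule prime_dvd_power_add[OF p])
  ultimately have "of_nat p dvd (((a + b) ^ (p ^ k)) ^ p - (a ^ (p ^ k) + b ^ (p ^ k)) ^ p) +
     ((a ^ (p ^ k) + b ^ (p ^ k)) ^ p - ((a ^ (p ^ k)) ^ p + (b ^ (p ^ k)) ^ p))"
    by (rule dvd_add)
  thus ?case by (simp only: power_mult[symmetric] power_Suc2 diff_add_cancel add_diff_eq)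
qed simp

text \<open>Fermat's little theorem: additivity of the \<open>p\<close>-th power modulo
  \<open>p\<close> carries it from \<open>b\<close> to \<open>b + 1\<close> and back, which reaches
  all integers from 0; then iterate.\<close>

lemma prime_dvd_int_power_diff:
  fixes a :: int
  assumes p: "prime p"
  shows "int p dvd a ^ (p ^ k) - a"
proof (induction k)
  case (Suc k)
  have p0: "p > 0" using p prime_gt_0_nat by blast
  have step: "int p dvd (b + 1) ^ p - (b + 1) \<longleftrightarrow> int p dvd b ^ p - b" for b :: int
  proof -
    have "int p dvd (b + 1) ^ p - (b ^ p + 1)" using prime_dvd_power_add[OF p, of b 1] by simp
    hence "int p dvd ((b + 1) ^ p - (b ^ p + 1)) + (b ^ p - b) \<longleftrightarrow> int p dvd b ^ p - b"
      by (rule dvd_add_right_iff)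
    thus ?thesis by (simp add: algebra_simps)
  qed
  have 1: "int p dvd b ^ p - b" for b :: int
  proof (induction b rule: int_induct[of _ 0])
    case (step2 i)
    thus ?case using step[of "i - 1"] by simp
  qed (use p0 step in \<open>auto simp: power_0_left\<close>)
  have "int p dvd (a ^ (p ^ k)) ^ p - a ^ p" by (rule dvd_diff_power[OF Suc])
  moreover have "int p dvd a ^ p - a" by (rule 1)
  ultimately have "int p dvd ((a ^ (p ^ k)) ^ p - a ^ p) + (a ^ p - a)" by (rule dvd_add)
  thus ?case by (simp add: power_mult[symmetric] mult.commute)
qed simp

text \<open>Writing a polynomial as \<open>a + x * f\<close>, the power is additive modulo
  \<open>p\<close> and fixes the constant \<open>a\<close>, so only the variable gets
  raised.\<close>

lemma prime_dvd_int_poly_frobenius: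
  fixes f :: "int poly"
  assumes p: "prime p"
  shows "of_nat p dvd f ^ (p ^ k) - pcompose f (monom 1 (p ^ k))"
proof (induction f)
  case 0
  have "p ^ k > 0" using p prime_gt_0_nat by simp
  thus ?case by (simp add: power_0_left)
next
  case (pCons a f)
  let ?q = "p ^ k" let ?x = "monom 1 1 :: int poly"
  have e: "pCons a f = [:a:] + ?x * f" by (simp add: monom_altdef)
  have 1: "of_nat p dvd (pCons a f) ^ ?q - ([:a:] ^ ?q + (?x * f) ^ ?q)"
    unfolding e by (rule prime_dvd_prime_power_add[OF p])
  have "[:int p:] dvd [:a ^ ?q - a:]"
    using prime_dvd_int_power_diff[OF p, of a k] by (simp add: const_poly_dvd)
  hence 2: "of_nat p dvd [:a:] ^ ?q - [:a:]"
    by (simp add: of_nat_poly poly_const_pow)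
  have "of_nat p dvd monom 1 ?q * (f ^ ?q - pcompose f (monom 1 ?q))"
    using pCons.IH by (rule dvd_mult)
  hence 3: "of_nat p dvd (?x * f) ^ ?q - monom 1 ?q * pcompose f (monom 1 ?q)"
    by (simp add: power_mult_distrib monom_power right_diff_distrib)
  have "(pCons a f) ^ ?q - pcompose (pCons a f) (monom 1 ?q) =
     ((pCons a f) ^ ?q - ([:a:] ^ ?q + (?x * f) ^ ?q)) + ([:a:] ^ ?q - [:a:]) +
     ((?x * f) ^ ?q - monom 1 ?q * pcompose f (monom 1 ?q))"
    by (simp add: pcompose_pCons)
  with dvd_add[OF dvd_add[OF 1 2] 3] show ?case by metis
qed

section \<open>Roots of unity and finite fields as quotients of the integer polynomials\<close>

text \<open>An eigenvalue of an integer matrix is a root of its monic characteristic polynomial.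
  This later excludes the value \<open>1 / p\<close>, which is rational but no integer.\<close>

lemma algebraic_int_poly_root_of_unity:
  fixes z :: complex
  assumes z: "z ^ N = 1" and N: "N > 0"
  shows "algebraic_int (poly (of_int_poly g) z)"
proof -
  \<comment> \<open>A circulant matrix, which has the value of \<^term>\<open>g\<close> at \<^term>\<open>z\<close> as an eigenvalue.\<close>
  define A where "A = mat N N (\<lambda>(i,j). \<Sum>k\<le>degree g. if (i + k) mod N = j then coeff g k else 0)"
  define B where "B = map_mat complex_of_int A"
  define v where "v = vec N (\<lambda>j. z ^ j)"
  define ev where "ev = poly (of_int_poly g) z"
  have A: "A \<in> carrier_mat N N" and B: "B \<in> carrier_mat N N" by (auto simp: A_def B_def)
  have zmod: "z ^ (m mod N) = z ^ m" for m
    by (metis z div_mult_mod_eq mult.left_neutral power_add power_mult mult.commute power_one)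
  have evs: "ev = (\<Sum>k\<le>degree g. of_int (coeff g k) * z ^ k)"
    unfolding ev_def by (simp add: poly_altdef degree_map_poly coeff_map_poly)
  have "B *\<^sub>v v = ev \<cdot>\<^sub>v v"
  proof (rule eq_vecI)
    show "dim_vec (B *\<^sub>v v) = dim_vec (ev \<cdot>\<^sub>v v)" using B by (simp add: v_def)
    fix i assume "i < dim_vec (ev \<cdot>\<^sub>v v)"
    hence i: "i < N" by (simp add: v_def)
    have "(B *\<^sub>v v) $ i = (\<Sum>j<N. (\<Sum>k\<le>degree g. if (i + k) mod N = j then of_int (coeff g k) else 0) * z ^ j)"
      using i B unfolding B_def A_def v_def
      by (simp add: scalar_prod_def lessThan_atLeast0 if_distrib[of of_int] cong: if_cong)
    also have "\<dots> = (\<Sum>j<N. \<Sum>k\<le>degree g. if (i + k) mod N = j then of_int (coeff g k) * z ^ j else 0)"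
      by (intro sum.cong refl) (simp add: sum_distrib_right if_distrib[of "\<lambda>x. x * _"] cong: if_cong)
    also have "\<dots> = (\<Sum>k\<le>degree g. \<Sum>j<N. if (i + k) mod N = j then of_int (coeff g k) * z ^ j else 0)"
      by (rule sum.swap)
    also have "\<dots> = (\<Sum>k\<le>degree g. of_int (coeff g k) * z ^ ((i + k) mod N))"
      using N by (intro sum.cong refl) simp
    also have "\<dots> = ev * z ^ i"
      unfolding evs zmod by (simp add: sum_distrib_left power_add mult_ac)
    finally show "(B *\<^sub>v v) $ i = (ev \<cdot>\<^sub>v v) $ i" using i by (simp add: v_def)
  qed
  moreover have "v \<noteq> 0\<^sub>v N"
  proof
    assume "v = 0\<^sub>v N"
    hence "v $ 0 = 0" using N by simp
    thus False using N by (simp add: v_def)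
  qed
  ultimately have "eigenvalue B ev" unfolding eigenvalue_def eigenvector_def
    using B by (intro exI[of _ v]) (auto simp: v_def)
  hence "poly (char_poly B) ev = 0" using eigenvalue_root_char_poly[OF B] by simp
  moreover have "char_poly B = of_int_poly (char_poly A)"
    unfolding B_def by (rule of_int_hom.char_poly_hom[OF A])
  moreover have "lead_coeff (char_poly A) = 1" using degree_monic_char_poly[OF A] by simp
  ultimately show ?thesis unfolding algebraic_int_altdef_ipoly ev_def by auto
qed

text \<open>Both sides are monic of degree \<open>N\<close> in \<open>y\<close> and vanish at the
  \<open>N\<close> roots of unity; their difference has degree below \<open>N\<close> and
  \<open>N\<close> zeros.\<close>

lemma prod_diff_roots_of_unity:
  fixes y :: complex
  assumes N: "N > 0"
  shows "(\<Prod>i<N. y - cis (2 * pi * real i / real N)) = y ^ N - 1"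
proof -
  define S where "S = {z::complex. z ^ N = 1}"
  have fin: "finite S" unfolding S_def using N by (intro finite_roots_unity) auto
  have card: "card S = N" unfolding S_def using N by (rule card_roots_unity_eq)
  define P where "P = (\<Prod>a\<in>S. [:- a, 1:])"
  define R where "R = (monom 1 N + [:-1:] :: complex poly)"
  have degR: "degree R = N" unfolding R_def using N
    by (subst degree_add_eq_left) (auto simp: degree_monom_eq)
  have lcR: "lead_coeff R = 1" unfolding degR unfolding R_def using N by (cases N) simp_all
  have degP: "degree P = N" unfolding P_def using card by (simp add: degree_prod_eq_sum_degree)
  have lcP: "lead_coeff P = 1" unfolding P_def by (simp add: lead_coeff_prod)
  have "R - P = 0"
  proof (rule poly_eqI_degree[of S])
    show "poly (R - P) x = poly 0 x" if "x \<in> S" for x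
      using that fin by (auto simp: R_def P_def poly_prod S_def poly_monom)
    show "degree (0::complex poly) < card S" using card N by simp
    have "coeff (R - P) N = 0" using lcR lcP degR degP by simp
    moreover have "degree (R - P) \<le> N" using degR degP by (intro degree_diff_le) auto
    ultimately show "degree (R - P) < card S" unfolding card using N
      by (metis coeff_0 degree_0 le_neq_implies_less leading_coeff_0_iff)
  qed
  hence "poly R y = poly P y" by simp
  hence "y ^ N - 1 = (\<Prod>a\<in>S. y - a)" by (simp add: R_def P_def poly_prod poly_monom)
  also have "\<dots> = (\<Prod>i<N. y - cis (2 * pi * real i / real N))"
    using Complex.bij_betw_roots_unity[OF N] unfolding S_def
    by (subst prod.reindex_bij_betw[symmetric]) auto
  finally show ?thesis by simp
qed

text \<open>
  The ideal \<^term>\<open>M\<close> is maximal among those containing every polynomial whose value at a primitive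
  \<open>(Q - 1)\<close>-th root of unity \<open>z\<close> lies in \<open>p\<int>[z]\<close>, where \<open>Q\<close> is a power of \<open>p\<close>; such ideals exist
  because \<open>1 / p\<close> is not an algebraic integer. Modulo \<open>M\<close> every \<open>f\<close> satisfies \<open>f\<^sup>Q = f\<close>, so it is a root of
  \<open>Y \<Prod>\<^sub>i (Y - z\<^sup>i)\<close>, and \<open>0\<close> together with the powers of \<open>z\<close> represents all residue classes.
\<close>

lemma ex_finite_field_quotient:
  fixes Q :: nat
  assumes Q: "primepow Q"
  shows "\<exists>(M::int poly set) (e::nat \<Rightarrow> int poly). is_ideal M \<and> (\<forall>f. \<exists>i<Q. f - e i \<in> M) \<and>
     (\<forall>i<Q. \<forall>j<Q. i \<noteq> j \<longrightarrow> e i - e j \<notin> M) \<and> (\<forall>a. a \<notin> M \<longrightarrow> (\<exists>b. 1 - a * b \<in> M))"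
proof -
  from Q obtain p k where p: "prime p" and k: "k > 0" and Qp: "Q = p ^ k"
    by (auto simp: primepow_def)
  have Q2: "Q \<ge> 2" using primepow_gt_Suc_0 Q by (metis Suc_leI numeral_2_eq_2)
  define N where "N = Q - 1"
  have N: "N > 0" and QN: "Q = Suc N" using Q2 by (auto simp: N_def)
  define z where "z = cis (2 * pi / real N)"
  have zi: "z ^ i = cis (2 * pi * real i / real N)" for i
    unfolding z_def by (simp add: Complex.DeMoivre mult_ac)
  have zN: "z ^ N = 1" unfolding zi using N by simp
  have z0: "z \<noteq> 0" unfolding z_def by simp
  have zinj: "z ^ i \<noteq> z ^ j" if "i < N" "j < N" "i \<noteq> j" for i j
    using Complex.bij_betw_roots_unity[OF N] that unfolding zi bij_betw_def inj_on_def by auto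
  define ev where "ev f = poly (of_int_poly f) z" for f :: "int poly"
  have ev_add: "ev (f + g) = ev f + ev g" and ev_diff: "ev (f - g) = ev f - ev g"
    and ev_mult: "ev (f * g) = ev f * ev g" and ev_pow: "ev (f ^ n) = ev f ^ n" 
    and ev_1: "ev 1 = 1" and ev_0: "ev 0 = 0" and ev_mon: "ev (monom 1 n) = z ^ n" 
    and ev_nat: "ev (of_nat n) = of_nat n" for f g n
    by (simp_all add: ev_def hom_distribs poly_monom of_nat_poly map_poly_pCons)
  have ev_sum: "ev (sum h B) = (\<Sum>i\<in>B. ev (h i))" and ev_prod: "ev (prod h B) = (\<Prod>i\<in>B. ev (h i))" 
    for h and B :: "nat set"
    by (induction B rule: infinite_finite_induct) (auto simp: ev_0 ev_1 ev_add ev_mult)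
  define I where "I = {f. \<exists>g. ev f = of_nat p * ev g}"
  have I: "is_ideal I"
    unfolding is_ideal_def I_def
  proof (safe)
    show "\<exists>g. ev 0 = of_nat p * ev g" by (rule exI[of _ 0]) (simp add: ev_0)
  next
    fix a b g h assume "ev a = of_nat p * ev g" "ev b = of_nat p * ev h"
    thus "\<exists>g. ev (a + b) = of_nat p * ev g"
      by (intro exI[of _ "g + h"]) (simp add: ev_add algebra_simps)
  next
    fix r a g assume "ev a = of_nat p * ev g"
    thus "\<exists>g. ev (r * a) = of_nat p * ev g"
      by (intro exI[of _ "r * g"]) (simp add: ev_mult algebra_simps)
  qed
  have I0: "f \<in> I" if "ev f = 0" for f using that unfolding I_def
    by (intro CollectI exI[of _ 0]) (simp add: ev_0)
  have "1 \<notin> I"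
  proof
    assume "1 \<in> I"
    then obtain g where g: "1 = of_nat p * ev g" by (auto simp: I_def ev_1)
    have p0: "p \<noteq> 0" using p by auto
    have e: "ev g = 1 / of_nat p" using g p0 by (simp add: field_simps)
    have "algebraic_int (ev g)" unfolding ev_def
      by (rule algebraic_int_poly_root_of_unity[OF zN N])
    moreover have "ev g \<in> \<rat>" unfolding e by (intro Rats_divide) auto
    ultimately have "ev g \<in> \<int>" by (rule rational_algebraic_int_is_int)
    then obtain n where "ev g = of_int n" by (auto elim: Ints_cases)
    with g have "(of_int 1 :: complex) = of_int (int p * n)" by simp
    hence "1 = int p * n" by (simp only: of_int_eq_iff)
    hence "int p dvd 1" by (metis dvd_triv_left)
    thus False using p by (simp add: prime_nat_iff)
  qed
  from ex_maximal_ideal[OF I this] obtain M where M: "is_ideal M" and IM: "I \<subseteq> M"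
    and M1: "1 \<notin> M" and inv: "\<And>a. a \<notin> M \<Longrightarrow> \<exists>b. 1 - a * b \<in> M" by blast
  \<comment> \<open>\<open>M\<close> contains the kernel of \<open>ev\<close>, so congruences modulo
    \<open>M\<close> may be verified as equations at the complex number \<open>z\<close>.\<close>
  have M0: "f \<in> M" if "ev f = 0" for f using I0[OF that] IM by blast
  \<comment> \<open>Maximal ideals are prime; this turns the vanishing of a product into the
    vanishing of a factor.\<close>
  have prm: "a \<in> M \<or> b \<in> M" if "a * b \<in> M" for a b
  proof (rule ccontr)
    assume "\<not> (a \<in> M \<or> b \<in> M)"
    then obtain c where "1 - a * c \<in> M" and b: "b \<notin> M" using inv by blast
    hence "b * (1 - a * c) + c * (a * b) \<in> M" using that by (blast intro: is_idealD[OF M])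
    with b show False by (simp add: algebra_simps)
  qed
  have prm': "\<exists>i\<in>B. h i \<in> M" if "finite B" "prod h B \<in> M" for h and B :: "nat set"
    using that(1,2) by (induction B rule: finite_induct) (use M1 prm in auto)
  have pM: "of_nat p \<in> M"
    using IM by (auto simp: I_def ev_nat intro!: exI[of _ 1] simp: ev_1)
  have frob: "f ^ Q - f \<in> M" for f
  proof -
    from prime_dvd_int_poly_frobenius[OF p, of f k]
    obtain g where "f ^ Q - pcompose f (monom 1 Q) = of_nat p * g" unfolding Qp by (elim dvdE)
    hence "f ^ Q - pcompose f (monom 1 Q) \<in> M" using pM is_idealD(4)[OF M] by simp
    moreover have "ev (pcompose f (monom 1 Q)) = poly (of_int_poly f) (z ^ Q)"
    proof (induction f)
      case (pCons a f)
      have "ev [:a:] = of_int a" by (cases "a = 0") (simp_all add: ev_def map_poly_pCons)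
      thus ?case using pCons by (simp add: pcompose_pCons ev_add ev_mult ev_mon map_poly_pCons)
    qed (simp add: ev_0)
    \<comment> \<open>Here \<open>z ^ Q = z\<close>, so replacing the variable by its
      \<open>Q\<close>-th power keeps the value at \<open>z\<close>.\<close>
    hence "ev (pcompose f (monom 1 Q) - f) = 0"
      unfolding ev_diff using zN by (simp add: ev_def QN)
    hence "pcompose f (monom 1 Q) - f \<in> M" by (rule M0)
    ultimately have "(f ^ Q - pcompose f (monom 1 Q)) + (pcompose f (monom 1 Q) - f) \<in> M"
      by (rule is_idealD(2)[OF M])
    thus ?thesis by simp
  qed
  define e where "e i = (if i = 0 then 0 else monom 1 (i - 1) :: int poly)" for i :: nat
  have cover: "\<exists>i<Q. f - e i \<in> M" for f
  proof -
    have "f * (\<Prod>i<N. f - monom 1 i) - (f ^ Q - f) \<in> M"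
    proof (rule M0)
      have pr: "(\<Prod>i<N. ev f - z ^ i) = ev f ^ N - 1"
        using prod_diff_roots_of_unity[OF N, of "ev f"] unfolding zi .
      thus "ev (f * (\<Prod>i<N. f - monom 1 i) - (f ^ Q - f)) = 0"
        unfolding ev_diff ev_mult ev_prod ev_pow ev_mon pr by (simp add: QN algebra_simps)
    qed
    from is_idealD(2)[OF M this frob[of f]] have "f * (\<Prod>i<N. f - monom 1 i) \<in> M" by simp
    from prm[OF this] show ?thesis
    proof
      assume "f \<in> M"
      thus ?thesis using Q2 by (intro exI[of _ 0]) (auto simp: e_def)
    next
      assume "(\<Prod>i<N. f - monom 1 i) \<in> M"
      from prm'[OF _ this] obtain i where "i < N" "f - monom 1 i \<in> M" by auto
      thus ?thesis by (intro exI[of _ "Suc i"]) (auto simp: e_def QN)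
    qed
  qed
  \<comment> \<open>The monomial of degree \<open>N - i\<close> is an inverse modulo
    \<open>M\<close>.\<close>
  have xM: "monom 1 i \<notin> M" if "i < N" for i
  proof
    assume "monom 1 i \<in> M"
    hence "monom 1 (N - i) * monom 1 i \<in> M" by (rule is_idealD(3)[OF M])
    moreover have "1 - monom 1 (N - i) * monom 1 i \<in> M"
      using that zN by (intro M0) (simp add: ev_diff ev_mult ev_mon ev_1 flip: power_add)
    ultimately have "(1 - monom 1 (N - i) * monom 1 i) + monom 1 (N - i) * monom 1 i \<in> M"
      using is_idealD(2)[OF M] by blast
    thus False using M1 by simp
  qed
  \<comment> \<open>Otherwise \<open>t\<close>, the monomial of degree \<open>i - j\<close>, is
    congruent to 1, and the sum of its first \<open>N\<close> powers is congruent to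
    \<open>N\<close>. At \<open>z\<close> that sum is a geometric sum over an \<open>N\<close>-th
    root of unity other than 1, hence zero. So \<open>M\<close> contains \<open>N\<close> and also
    \<open>Q = N + 1\<close>, a multiple of \<open>p\<close>, and therefore 1.\<close>
  have d1: "monom 1 i - monom 1 j \<notin> M" if ij: "j < i" "i < N" for i j
  proof
    assume "monom 1 i - monom 1 j \<in> M"
    moreover define t where "t = (monom 1 (i - j) :: int poly)"
    moreover have "monom 1 i = t * monom 1 j" using ij by (simp add: t_def mult_monom)
    ultimately have "monom 1 j * (t - 1) \<in> M" by (simp add: algebra_simps)
    with prm xM[of j] ij have t1: "t - 1 \<in> M" by fastforce
    have tk: "t ^ m - 1 \<in> M" for m
    proof (induction m)
      case (Suc m)
      have "t * (t ^ m - 1) + (t - 1) \<in> M" using Suc t1 by (blast intro: is_idealD[OF M])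
      thus ?case by (simp add: algebra_simps)
    qed (use is_idealD(1)[OF M] in simp)
    define w where "w = z ^ (i - j)"
    have w1: "w \<noteq> 1" using zinj[of "i - j" 0] ij by (simp add: w_def)
    have wN: "w ^ N = 1" unfolding w_def using zN by (metis power_mult mult.commute power_one)
    have "(\<Sum>m<N. t ^ m) \<in> M"
    proof (rule M0)
      have "(\<Sum>m<N. w ^ m) = 0" using w1 wN by (simp add: sum_gp_strict)
      thus "ev (\<Sum>m<N. t ^ m) = 0" by (simp add: ev_sum ev_pow t_def ev_mon w_def)
    qed
    moreover have "(\<Sum>m<N. t ^ m - 1) \<in> M" by (intro is_ideal_sum[OF M] tk)
    ultimately have "(\<Sum>m<N. t ^ m) - (\<Sum>m<N. t ^ m - 1) \<in> M" by (rule is_idealD(6)[OF M])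
    hence NM: "of_nat N \<in> M" by (simp add: sum_subtractf)
    have "of_nat p * of_nat (p ^ (k - 1)) \<in> M" using pM by (rule is_idealD(4)[OF M])
    moreover have "of_nat p * of_nat (p ^ (k - 1)) = (of_nat Q :: int poly)"
      using k unfolding Qp by (cases k) auto
    ultimately have "of_nat Q - of_nat N \<in> M" using NM is_idealD(6)[OF M] by simp
    thus False using M1 by (simp add: QN)
  qed
  have d2: "monom 1 i - monom 1 j \<notin> M" if ij: "j < N" "i < N" "i \<noteq> j" for i j
  proof (cases "j < i")
    case False
    hence "monom 1 j - monom 1 i \<notin> M" using ij by (intro d1) auto
    thus ?thesis using is_idealD(5)[OF M, of "monom 1 i - monom 1 j"] by auto
  qed (use d1 ij in auto)
  have "e i - e j \<notin> M" if ij: "i < Q" "j < Q" "i \<noteq> j" for i j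
  proof -
    consider "i = 0" "j > 0" | "i > 0" "j = 0" | "i > 0" "j > 0" using ij(3) by (metis gr0I)
    thus ?thesis
    proof cases
      case 1
      thus ?thesis using that xM[of "j - 1"] is_idealD(5)[OF M, of "e i - e j"]
        by (auto simp: e_def QN)
    next
      case 2
      thus ?thesis using that xM[of "i - 1"] by (auto simp: e_def QN)
    next
      case 3
      thus ?thesis using that d2[of "j - 1" "i - 1"] by (auto simp: e_def QN)
    qed
  qed
  with M cover inv show ?thesis by blast
qed

section \<open>The affine plane over a finite field\<close>

text \<open>
  Points of the affine plane over the field of order \<open>Q\<close> are numbered below \<open>Q\<^sup>2\<close> and parallel classes are
  numbered \<open>0, \<dots>, Q\<close>; \<open>c t m\<close> is the line of class \<open>m\<close> through the point \<open>t\<close>.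
\<close>

lemma ex_affine_plane:
  fixes Q :: nat
  assumes Q: "primepow Q"
  shows "\<exists>c :: nat \<Rightarrow> nat \<Rightarrow> nat. (\<forall>t m. c t m < Q) \<and>
    (\<forall>s<Q^2. \<forall>t<Q^2. s \<noteq> t \<longrightarrow> (\<exists>!m. m \<le> Q \<and> c s m = c t m))"
proof -
  obtain M :: "int poly set" and e where M: "is_ideal M" and cov: "\<And>f. \<exists>i<Q. f - e i \<in> M"
    and dst: "\<And>i j. i < Q \<Longrightarrow> j < Q \<Longrightarrow> i \<noteq> j \<Longrightarrow> e i - e j \<notin> M"
    and inv: "\<And>a. a \<notin> M \<Longrightarrow> \<exists>b. 1 - a * b \<in> M"
    using ex_finite_field_quotient[OF Q] by blast
  have Q0: "Q > 0" using primepow_gt_0_nat[OF Q] .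
  define r where "r f = (SOME i. i < Q \<and> f - e i \<in> M)" for f
  have r: "r f < Q" "f - e (r f) \<in> M" for f
    using someI_ex[OF cov[of f]] unfolding r_def by auto
  have req: "r f = r g \<longleftrightarrow> f - g \<in> M" for f g
  proof
    assume "r f = r g"
    with is_idealD(6)[OF M r(2)[of f] r(2)[of g]] show "f - g \<in> M" by simp
  next
    assume fg: "f - g \<in> M"
    have "(f - e (r f)) - (f - g) - (g - e (r g)) \<in> M"
      by (rule is_idealD(6)[OF M is_idealD(6)[OF M r(2) fg] r(2)])
    hence "e (r g) - e (r f) \<in> M" by simp
    thus "r f = r g" using dst r(1) by metis
  qed
  \<comment> \<open>The base-\<open>Q\<close> digits of a point are its coordinates, read as field
    elements through \<open>e\<close>. Class \<open>Q\<close> holds the vertical lines; class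
    \<open>m < Q\<close> holds the lines of slope \<open>- e m\<close>, labelled by their
    intercept.\<close>
  define X where "X t = t mod Q" for t
  define Y where "Y t = t div Q" for t
  define c where "c t m = (if m = Q then X t else r (e (Y t) + e m * e (X t)))" for t m
  have "\<exists>!m. m \<le> Q \<and> c s m = c t m" if st: "s < Q^2" "t < Q^2" "s \<noteq> t" for s t
  proof -
    have XY: "X s < Q" "X t < Q" "Y s < Q" "Y t < Q" using st Q0
      by (auto simp: X_def Y_def less_mult_imp_div_less power2_eq_square)
    have ne: "X s = X t \<Longrightarrow> Y s \<noteq> Y t" using st unfolding X_def Y_def by (metis div_mod_decomp)
    have ceq: "c s m = c t m \<longleftrightarrow> (e (Y s) - e (Y t)) + e m * (e (X s) - e (X t)) \<in> M" if "m < Q" for m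
    proof -
      have "(e (Y s) + e m * e (X s)) - (e (Y t) + e m * e (X t)) =
         (e (Y s) - e (Y t)) + e m * (e (X s) - e (X t))" by (simp add: algebra_simps)
      moreover have "c s m = c t m \<longleftrightarrow> (e (Y s) + e m * e (X s)) - (e (Y t) + e m * e (X t)) \<in> M"
        using that req by (simp add: c_def)
      ultimately show ?thesis by metis
    qed
    show ?thesis
    proof (cases "X s = X t")
      case True
      show ?thesis
      proof (intro ex1I[of _ Q] conjI)
        show "c s Q = c t Q" using True by (simp add: c_def)
        fix m assume m: "m \<le> Q \<and> c s m = c t m"
        show "m = Q"
        proof (rule ccontr)
          assume "m \<noteq> Q"
          with m ceq[of m] True have "e (Y s) - e (Y t) \<in> M" by simp
          thus False using dst ne[OF True] XY by blast
        qed
      qed simp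
    next
      case False
      define a where "a = e (X s) - e (X t)"
      define d where "d = e (Y s) - e (Y t)"
      have "a \<notin> M" using dst False XY by (simp add: a_def)
      then obtain b where b: "1 - a * b \<in> M" using inv by blast
      \<comment> \<open>The slope condition \<open>d + e m * a\<close> in \<open>M\<close> is linear
        with invertible coefficient \<open>a\<close>, so its only solution is the representative of
        \<open>- d * b\<close>.\<close>
      have ceq': "c s m = c t m \<longleftrightarrow> m = r (- d * b)" if m: "m < Q" for m
      proof -
        have "m = r (e m)" using m req[of "e m" "e (r (e m))"] r[of "e m"] dst[OF m r(1)[of "e m"]] by blast
        hence "m = r (- d * b) \<longleftrightarrow> r (e m) = r (- d * b)" by simp
        also have "\<dots> \<longleftrightarrow> e m + d * b \<in> M" by (simp add: req)
        also have "\<dots> \<longleftrightarrow> d + e m * a \<in> M"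
        proof
          assume "e m + d * b \<in> M"
          from is_idealD(2)[OF M is_idealD(3)[OF M this, of a] is_idealD(3)[OF M b, of d]]
          show "d + e m * a \<in> M" by (simp add: algebra_simps)
        next
          assume "d + e m * a \<in> M"
          from is_idealD(2)[OF M is_idealD(3)[OF M this, of b] is_idealD(3)[OF M b, of "e m"]]
          show "e m + d * b \<in> M" by (simp add: algebra_simps)
        qed
        finally show ?thesis using ceq[OF m] by (simp add: a_def d_def)
      qed
      show ?thesis
      proof (intro ex1I[of _ "r (- d * b)"] conjI)
        show "r (- d * b) \<le> Q" using r(1) less_imp_le by blast
        show "c s (r (- d * b)) = c t (r (- d * b))" using ceq'[OF r(1)] by simp
        fix m assume m: "m \<le> Q \<and> c s m = c t m"
        have "m \<noteq> Q" using m False by (auto simp: c_def)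
        thus "m = r (- d * b)" using m ceq'[of m] by simp
      qed
    qed
  qed
  moreover have "c t m < Q" for t m using r(1) Q0 by (simp add: c_def X_def)
  ultimately show ?thesis by blast
qed

section \<open>Invertible integer matrices and linear systems\<close>

text \<open>Solving for the unit vectors yields a right inverse, so the determinant is a unit and
  the scaled adjugate is a two-sided inverse. Invertibility can thus be checked by solving equations
  over the integers.\<close>

lemma Units_int_mat_ring_iff:
  assumes A: "A \<in> carrier_mat n n"
  shows "A \<in> Units (int_mat_ring n) \<longleftrightarrow>
    (\<forall>y. \<exists>x. \<forall>k<n. (\<Sum>l<n. A $$ (k, l) * x l) = y k)"
proof
  assume "A \<in> Units (int_mat_ring n)"
  then obtain B where B: "B \<in> carrier_mat n n" and AB: "A * B = 1\<^sub>m n"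
    unfolding Units_def ring_mat_simps by auto
  show "\<forall>y. \<exists>x. \<forall>k<n. (\<Sum>l<n. A $$ (k, l) * x l) = y k"
  proof (intro allI exI impI)
    fix y :: "nat \<Rightarrow> int" and k assume k: "k < n"
    have "(A *\<^sub>v (B *\<^sub>v vec n y)) = vec n y"
      using A B by (simp add: AB flip: assoc_mult_mat_vec[of _ n n _ n])
    hence "(A *\<^sub>v (B *\<^sub>v vec n y)) $ k = y k" using k by simp
    thus "(\<Sum>l<n. A $$ (k, l) * (B *\<^sub>v vec n y) $ l) = y k"
      using A B k by (simp add: scalar_prod_def lessThan_atLeast0)
  qed
next
  assume "\<forall>y. \<exists>x. \<forall>k<n. (\<Sum>l<n. A $$ (k, l) * x l) = y k"
  then obtain S where S: "\<And>y k. k < n \<Longrightarrow> (\<Sum>l<n. A $$ (k, l) * S y l) = y k" by metis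
  define B where "B = mat n n (\<lambda>(l, j). S (\<lambda>k. if k = j then 1 else 0) l)"
  have B: "B \<in> carrier_mat n n" by (simp add: B_def)
  have "A * B = 1\<^sub>m n"
  proof (rule eq_matI)
    fix k j assume "k < dim_row (1\<^sub>m n :: int mat)" "j < dim_col (1\<^sub>m n :: int mat)"
    hence kj: "k < n" "j < n" by auto
    have "(A * B) $$ (k, j) = (\<Sum>l<n. A $$ (k, l) * S (\<lambda>k. if k = j then 1 else 0) l)"
      using A kj by (simp add: B_def scalar_prod_def lessThan_atLeast0)
    thus "(A * B) $$ (k, j) = 1\<^sub>m n $$ (k, j)" using S[OF kj(1)] kj by simp
  qed (use A B in auto)
  hence d: "det A * det B = 1" using det_mult[OF A B] by simp
  define C where "C = det B \<cdot>\<^sub>m adj_mat A"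
  have C: "C \<in> carrier_mat n n" using adj_mat(1)[OF A] by (simp add: C_def)
  have "A * C = 1\<^sub>m n" "C * A = 1\<^sub>m n"
    unfolding C_def using A adj_mat[OF A] d
    by (auto simp: mult_smult_distrib mult_smult_assoc_mat mult.commute intro!: eq_matI)
  thus "A \<in> Units (int_mat_ring n)" unfolding Units_def ring_mat_simps using A C by auto
qed

lemma a_minus_int_mat_ring:
  assumes "A \<in> carrier_mat n n" "B \<in> carrier_mat n n"
  shows "A \<ominus>\<^bsub>int_mat_ring n\<^esub> B = A - B"
proof -
  interpret ring "int_mat_ring n" by (rule ring_mat)
  have "\<ominus>\<^bsub>int_mat_ring n\<^esub> B = - B"
    using assms by (intro minus_equality) (auto simp: ring_mat_simps)
  thus ?thesis using assms by (simp add: a_minus_def ring_mat_simps minus_add_uminus_mat)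
qed

lemma sum_div_mod:
  fixes F :: "nat \<Rightarrow> nat \<Rightarrow> 'a::comm_monoid_add"
  shows "(\<Sum>c<n*m. F (c div n) (c mod n)) = (\<Sum>i<m. \<Sum>l<n. F i l)"
proof (cases "n = 0")
  case False
  hence n: "n > 0" by simp
  have "(\<Sum>i<m. \<Sum>l<n. F i l) = (\<Sum>(i,l)\<in>{..<m} \<times> {..<n}. F i l)"
    by (simp add: sum.cartesian_product)
  also have "\<dots> = (\<Sum>c<n*m. F (c div n) (c mod n))"
  proof (rule sum.reindex_bij_witness[where j = "\<lambda>(i,l). n * i + l" and i = "\<lambda>c. (c div n, c mod n)"])
    fix p assume "p \<in> {..<m} \<times> {..<n}"
    then obtain i l where p: "p = (i, l)" "i < m" "l < n" by auto
    have "n * i + l < n * (i + 1)" using p by simp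
    also have "\<dots> \<le> n * m" using p by (intro mult_le_mono2) simp
    finally show "(case p of (i,l) \<Rightarrow> n * i + l) \<in> {..<n*m}" using p by simp
  qed (use n in \<open>auto simp: less_mult_imp_div_less mult.commute\<close>)
  finally show ?thesis by simp
qed simp

text \<open>Substitution in order: equation \<open>e t\<close> is satisfied by adjusting the unknown
  \<open>v t\<close>, which does not disturb the equations solved before.\<close>

lemma triangular_system_solvable:
  fixes P :: "'i \<Rightarrow> ('v \<Rightarrow> 'w) \<Rightarrow> bool" and m :: nat
  assumes solve: "\<And>t X. t < m \<Longrightarrow> \<exists>w. P (e t) (X(v t := w))"
    and indep: "\<And>s t X w. s < t \<Longrightarrow> t < m \<Longrightarrow> P (e s) X \<Longrightarrow> P (e s) (X(v t := w))"
  shows "\<exists>X. \<forall>t<m. P (e t) X"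
proof -
  have "t \<le> m \<Longrightarrow> \<exists>X. \<forall>s<t. P (e s) X" for t
  proof (induction t)
    case (Suc t)
    then obtain X where X: "\<forall>s<t. P (e s) X" by auto
    obtain w where "P (e t) (X(v t := w))" using solve[of t] Suc.prems by auto
    moreover have "P (e s) (X(v t := w))" if "s < t" for s
      using indep X that Suc.prems by simp
    ultimately show ?case by (metis less_Suc_eq)
  qed simp
  thus ?thesis by blast
qed

section \<open>Cyclic block matrices\<close>

text \<open>
  The \<open>m \<times> m\<close> block matrix with diagonal blocks \<open>a 0, \<dots>, a (m - 1)\<close> and cyclic superdiagonal
  blocks \<open>b 0, \<dots>, b (m - 1)\<close>.
\<close>

definition block_cyclic :: "nat \<Rightarrow> nat \<Rightarrow> (nat \<Rightarrow> int mat) \<Rightarrow> (nat \<Rightarrow> int mat) \<Rightarrow> int mat" where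
  "block_cyclic n m a b = mat (n * m) (n * m) (\<lambda>(r, c).
     (if c div n = r div n then a (r div n) $$ (r mod n, c mod n) else 0) +
     (if c div n = Suc (r div n) mod m then b (r div n) $$ (r mod n, c mod n) else 0))"

lemma block_cyclic_carrier: "block_cyclic n m a b \<in> carrier_mat (n * m) (n * m)"
  by (simp add: block_cyclic_def)

lemma block_cyclic_diff:
  assumes "n > 0" "\<And>i. a i \<in> carrier_mat n n" "\<And>i. b i \<in> carrier_mat n n"
    "\<And>i. a' i \<in> carrier_mat n n" "\<And>i. b' i \<in> carrier_mat n n"
  shows "block_cyclic n m a b - block_cyclic n m a' b' =
    block_cyclic n m (\<lambda>i. a i - a' i) (\<lambda>i. b i - b' i)"
proof -
  note dims = assms(2-5)[THEN carrier_matD(1)] assms(2-5)[THEN carrier_matD(2)]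
  show ?thesis by (rule eq_matI) (use assms(1) dims in \<open>auto simp: block_cyclic_def\<close>)
qed

lemma mod_add_inj:
  fixes s t m :: nat
  assumes "(j + s) mod m = (j + t) mod m" "s < t + m" "t < s + m"
  shows "s = t"
proof -
  have "s = t" if "s \<le> t" "(j + s) mod m = (j + t) mod m" "t < s + m" for s t
  proof (rule ccontr)
    assume "s \<noteq> t"
    have "m dvd (j + t) - (j + s)" using that by (subst mod_eq_dvd_iff_nat[symmetric]) auto
    hence "m dvd t - s" by simp
    moreover have "0 < t - s" "t - s < m" using that \<open>s \<noteq> t\<close> by auto
    ultimately show False by (auto dest: nat_dvd_not_less)
  qed
  thus ?thesis using assms by (metis nat_le_linear)
qed

text \<open>Cutting vectors of length \<open>n * m\<close> into \<open>m\<close> blocks of length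
  \<open>n\<close> turns the solvability criterion for units into a system of block
  equations.\<close>

lemma surj_block_imp_Units:
  assumes n: "n > 0" and m: "m > 0"
    and sol: "\<And>Y. \<exists>X :: nat \<Rightarrow> nat \<Rightarrow> int. \<forall>i<m. \<forall>k<n.
      (\<Sum>l<n. a i $$ (k, l) * X i l) + (\<Sum>l<n. b i $$ (k, l) * X (Suc i mod m) l) = Y i k"
  shows "block_cyclic n m a b \<in> Units (int_mat_ring (n * m))"
  unfolding Units_int_mat_ring_iff[OF block_cyclic_carrier]
proof
  fix y :: "nat \<Rightarrow> int"
  obtain X where X: "\<And>i k. i < m \<Longrightarrow> k < n \<Longrightarrow> (\<Sum>l<n. a i $$ (k, l) * X i l) +
      (\<Sum>l<n. b i $$ (k, l) * X (Suc i mod m) l) = y (n * i + k)"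
    using sol[of "\<lambda>i k. y (n * i + k)"] by blast
  show "\<exists>x. \<forall>r<n*m. (\<Sum>c<n*m. block_cyclic n m a b $$ (r, c) * x c) = y r"
  proof (intro exI allI impI)
    fix r assume r: "r < n * m"
    define i where "i = r div n" define k where "k = r mod n"
    have i: "i < m" and k: "k < n" and rik: "r = n * i + k"
      using r n by (auto simp: i_def k_def less_mult_imp_div_less mult.commute)
    have "(\<Sum>c<n*m. block_cyclic n m a b $$ (r, c) * X (c div n) (c mod n)) =
       (\<Sum>c<n*m. ((if c div n = i then a i $$ (k, c mod n) else 0) +
          (if c div n = Suc i mod m then b i $$ (k, c mod n) else 0)) * X (c div n) (c mod n))"
      using r by (intro sum.cong refl) (simp add: block_cyclic_def i_def k_def)
    also have "\<dots> = (\<Sum>j<m. \<Sum>l<n. ((if j = i then a i $$ (k, l) else 0) +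
          (if j = Suc i mod m then b i $$ (k, l) else 0)) * X j l)"
      by (rule sum_div_mod)
    also have "\<dots> = (\<Sum>j<m. (if j = i then \<Sum>l<n. a i $$ (k, l) * X j l else 0) +
          (if j = Suc i mod m then \<Sum>l<n. b i $$ (k, l) * X j l else 0))"
      by (intro sum.cong refl) (simp add: distrib_right sum.distrib)
    also have "\<dots> = y r" using i k m X rik by (simp add: sum.distrib)
    finally show "(\<Sum>c<n*m. block_cyclic n m a b $$ (r, c) * X (c div n) (c mod n)) = y r" .
  qed
qed

text \<open>Row \<open>i\<close> links the block unknowns \<open>i\<close> and \<open>i + 1\<close>
  modulo \<open>m\<close>. The zero block in row \<open>j\<close> cuts this cycle, and elimination
  starts there: backwards through the diagonal blocks, or forwards through the superdiagonal ones.
  The remaining blocks of the other family are arbitrary.\<close>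

lemma block_cyclic_Units:
  assumes n: "n > 0" and m: "m > 1" and j: "j < m"
    and ca: "\<And>i. a i \<in> carrier_mat n n" and cb: "\<And>i. b i \<in> carrier_mat n n"
    and units: "(\<forall>i<m. a i \<in> Units (int_mat_ring n)) \<and> b j = 0\<^sub>m n n \<or>
      (\<forall>i<m. b i \<in> Units (int_mat_ring n)) \<and> a j = 0\<^sub>m n n"
  shows "block_cyclic n m a b \<in> Units (int_mat_ring (n * m))"
proof (rule surj_block_imp_Units[OF n])
  show "m > 0" using m by simp
  fix Y :: "nat \<Rightarrow> nat \<Rightarrow> int"
  define P where "P i X \<longleftrightarrow> (\<forall>k<n. (\<Sum>l<n. a i $$ (k, l) * X i l) +
      (\<Sum>l<n. b i $$ (k, l) * X (Suc i mod m) l) = Y i k)" for i and X :: "nat \<Rightarrow> nat \<Rightarrow> int"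
  \<comment> \<open>This is where \<open>m > 1\<close> matters: the two blocks of a row act on
    different unknowns.\<close>
  have ne: "Suc i mod m \<noteq> i" if "i < m" for i using that m by (simp add: mod_Suc)
  have "\<exists>X. \<forall>i<m. P i X"
    using units
  proof (elim disjE conjE)
    assume au: "\<forall>i<m. a i \<in> Units (int_mat_ring n)" and bj: "b j = 0\<^sub>m n n"
    \<comment> \<open>Rows in the order \<open>j\<close>, \<open>j - 1\<close>, and so on
      cyclically; the form \<open>m - t\<close> avoids truncated subtraction. Row \<open>e s\<close>
      involves only the unknowns \<open>e s\<close> and \<open>e (s - 1)\<close>, and row
      \<open>j\<close> only its own.\<close>
    define e where "e t = (j + (m - t)) mod m" for t
    have em: "e t < m" for t using m by (simp add: e_def)
    have einj: "e s \<noteq> e t" if "s < t" "t < m" for s t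
    proof
      assume "e s = e t"
      hence "m - s = m - t" unfolding e_def by (rule mod_add_inj) (use that in auto)
      thus False using that by simp
    qed
    have "\<exists>X. \<forall>t<m. P (e t) X"
    proof (rule triangular_system_solvable[where v = e])
      fix t X assume "t < m"
      obtain w where "\<forall>k<n. (\<Sum>l<n. a (e t) $$ (k, l) * w l) =
          Y (e t) k - (\<Sum>l<n. b (e t) $$ (k, l) * X (Suc (e t) mod m) l)"
        using au em[of t] unfolding Units_int_mat_ring_iff[OF ca]
        by (blast dest: spec[of _ "\<lambda>k. Y (e t) k - (\<Sum>l<n. b (e t) $$ (k, l) * X (Suc (e t) mod m) l)"])
      thus "\<exists>w. P (e t) (X(e t := w))" using ne[OF em[of t]]
        by (intro exI[of _ w]) (simp add: P_def)
    next
      fix s t X w assume st: "s < t" "t < m" and P: "P (e s) X"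
      show "P (e s) (X(e t := w))"
      proof (cases "s = 0")
        case True
        have "e s = j" using True j by (simp add: e_def)
        thus ?thesis using P einj[OF st] by (simp add: P_def bj)
      next
        case False
        have "Suc (e s) mod m = Suc (j + (m - s)) mod m" by (simp add: e_def mod_Suc_eq)
        also have "Suc (j + (m - s)) = j + (m - (s - 1))" using False st by simp
        finally have "Suc (e s) mod m = e (s - 1)" by (simp add: e_def)
        moreover have "e (s - 1) \<noteq> e t" using st by (intro einj) auto
        ultimately show ?thesis using P einj[OF st] by (simp add: P_def)
      qed
    qed
    moreover have "e ` {..<m} = {..<m}"
      by (rule endo_inj_surj) (use em einj in \<open>auto simp: inj_on_def, metis nat_neq_iff\<close>)
    ultimately show ?thesis by (metis imageE lessThan_iff)
  next
    assume bu: "\<forall>i<m. b i \<in> Units (int_mat_ring n)" and aj: "a j = 0\<^sub>m n n"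
    \<comment> \<open>Rows in the order \<open>j\<close>, \<open>j + 1\<close>, and so on
      cyclically; row \<open>e t\<close> is solved for the next unknown
      \<open>e (Suc t)\<close>.\<close>
    define e where "e t = (j + t) mod m" for t
    have em: "e t < m" for t using m by (simp add: e_def)
    have se: "Suc (e t) mod m = e (Suc t)" for t by (simp add: e_def mod_Suc_eq)
    have einj: "e s \<noteq> e t" if "s < t" "t < s + m" for s t
      using mod_add_inj[of j s m t] that by (auto simp: e_def)
    have "\<exists>X. \<forall>t<m. P (e t) X"
    proof (rule triangular_system_solvable[where v = "\<lambda>t. e (Suc t)"])
      fix t X assume "t < m"
      obtain w where "\<forall>k<n. (\<Sum>l<n. b (e t) $$ (k, l) * w l) =
          Y (e t) k - (\<Sum>l<n. a (e t) $$ (k, l) * X (e t) l)"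
        using bu em[of t] unfolding Units_int_mat_ring_iff[OF cb]
        by (blast dest: spec[of _ "\<lambda>k. Y (e t) k - (\<Sum>l<n. a (e t) $$ (k, l) * X (e t) l)"])
      thus "\<exists>w. P (e t) (X(e (Suc t) := w))" using ne[OF em[of t]] se[of t]
        by (intro exI[of _ w]) (simp add: P_def)
    next
      fix s t X w assume st: "s < t" "t < m" and P: "P (e s) X"
      have 1: "e (Suc s) \<noteq> e (Suc t)" using st by (intro einj) auto
      show "P (e s) (X(e (Suc t) := w))"
      \<comment> \<open>For \<open>t = m - 1\<close> the adjusted unknown is \<open>j\<close> again.
        Row \<open>j\<close> ignores it because \<open>a j\<close> vanishes, and for
        \<open>s > 0\<close> the indices stay less than \<open>m\<close> apart.\<close>
      proof (cases "s = 0")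
        case True
        have "e s = j" using True j by (simp add: e_def)
        thus ?thesis using P 1 se[of s] by (simp add: P_def aj)
      next
        case False
        have "e s \<noteq> e (Suc t)" using st False by (intro einj) auto
        thus ?thesis using P 1 se[of s] by (simp add: P_def)
      qed
    qed
    moreover have "e ` {..<m} = {..<m}"
    proof (rule endo_inj_surj)
      show "inj_on e {..<m}"
        by (rule linorder_inj_onI') (use einj in auto)
    qed (use em in auto)
    ultimately show ?thesis by (metis imageE lessThan_iff)
  qed
  thus "\<exists>X. \<forall>i<m. \<forall>k<n. (\<Sum>l<n. a i $$ (k, l) * X i l) +
      (\<Sum>l<n. b i $$ (k, l) * X (Suc i mod m) l) = Y i k"
    unfolding P_def .
qed

lemma zero_not_Units_int_mat_ring:
  assumes "n > 0"
  shows "0\<^sub>m n n \<notin> Units (int_mat_ring n)"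
proof
  assume "0\<^sub>m n n \<in> Units (int_mat_ring n)"
  from this[unfolded Units_int_mat_ring_iff[OF zero_carrier_mat], rule_format, of "\<lambda>_. 1"]
  show False using assms by auto
qed

section \<open>Squaring the size of a clique\<close>

lemma has_exceptional_clique_square:
  fixes c :: "nat \<Rightarrow> nat \<Rightarrow> nat"
  assumes n: "n > 0" and Q: "Q \<ge> 2"
    and C: "has_exceptional_clique_of_size (int_mat_ring n) Q"
    and c: "\<And>t k. c t k < Q"
    and plane: "\<And>s t. s < Q\<^sup>2 \<Longrightarrow> t < Q\<^sup>2 \<Longrightarrow> s \<noteq> t \<Longrightarrow> \<exists>!k. k \<le> Q \<and> c s k = c t k"
  shows "has_exceptional_clique_of_size (int_mat_ring (n * (Q div 2 + 1))) (Q\<^sup>2)"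
proof -
  \<comment> \<open>The least number of blocks whose \<open>2 * m\<close> positions accommodate all
    \<open>Q + 1\<close> parallel classes.\<close>
  define m where "m = Q div 2 + 1"
  have m: "m > 1" "m \<le> Q" "2 * m \<ge> Q + 1" using Q by (auto simp: m_def)
  from C obtain K where K: "K \<subseteq> carrier_mat n n" "finite K" "card K = Q"
    and Ku: "\<And>u v. u \<in> K \<Longrightarrow> v \<in> K \<Longrightarrow> u \<noteq> v \<Longrightarrow> u \<ominus>\<^bsub>int_mat_ring n\<^esub> v \<in> Units (int_mat_ring n)"
    unfolding has_exceptional_clique_of_size_def exceptional_clique_def ring_mat_simps by auto
  obtain h where h: "bij_betw h {0..<Q} K"
    using ex_bij_betw_nat_finite[OF K(2)] K(3) by auto
  define g where "g t k = h (c t k)" for t k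
  have gK: "g t k \<in> K" for t k using bij_betwE[OF h] c by (simp add: g_def)
  hence gc: "g t k \<in> carrier_mat n n" for t k using K(1) by blast
  have geq: "g s k = g t k \<longleftrightarrow> c s k = c t k" for s t k
    using bij_betw_imp_inj_on[OF h] c unfolding g_def by (auto dest: inj_onD)
  have gu: "g s k - g t k \<in> Units (int_mat_ring n)" if "c s k \<noteq> c t k" for s t k
    using Ku[OF gK gK, of s k t k] that geq a_minus_int_mat_ring[OF gc gc] by simp
  have g0: "g s k - g t k = 0\<^sub>m n n" if "c s k = c t k" for s t k
    using geq[of s k t] that minus_r_inv_mat[OF gc] by simp
  \<comment> \<open>For even \<^term>\<open>Q\<close> there is one block more than there are parallel classes; class \<^term>\<open>Q\<close> fills
    two superdiagonal blocks, which does no harm since superdiagonal blocks may vanish together.\<close>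
  define D where "D t = block_cyclic n m (g t) (\<lambda>i. g t (min (m + i) Q))" for t
  have Dc: "D t \<in> carrier_mat (n * m) (n * m)" for t
    unfolding D_def by (rule block_cyclic_carrier)
  have Du: "D s - D t \<in> Units (int_mat_ring (n * m))" if st: "s < Q\<^sup>2" "t < Q\<^sup>2" "s \<noteq> t" for s t
  proof -
    obtain k where k: "k \<le> Q" "c s k = c t k" and uniq: "\<And>l. l \<le> Q \<Longrightarrow> l \<noteq> k \<Longrightarrow> c s l \<noteq> c t l"
      using plane[OF st] by blast
    have e: "D s - D t = block_cyclic n m (\<lambda>i. g s i - g t i)
        (\<lambda>i. g s (min (m + i) Q) - g t (min (m + i) Q))"
      unfolding D_def by (rule block_cyclic_diff) (use n gc in auto)
    have ca: "\<And>i. g s i - g t i \<in> carrier_mat n n" by (rule minus_carrier_mat[OF gc])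
    \<comment> \<open>The common class \<open>k\<close> sits on the diagonal if \<open>k < m\<close>
      and in superdiagonal row \<open>k - m\<close> otherwise; the opposite family then consists of
      units.\<close>
    show ?thesis
    proof (cases "k < m")
      case True
      have "min (m + i) Q \<noteq> k" for i using True m by simp
      thus ?thesis unfolding e
        by (intro block_cyclic_Units[OF n m(1) True ca ca] disjI2)
          (use k in \<open>simp add: g0 gu uniq\<close>)
    next
      case False
      have "k - m < m" using k(1) m False by linarith
      moreover have "min (m + (k - m)) Q = k" using False k(1) by simp
      moreover have "i \<noteq> k" "i \<le> Q" if "i < m" for i using that False m by auto
      ultimately show ?thesis unfolding e
        by (intro block_cyclic_Units[OF n m(1) _ ca ca, of "k - m"] disjI1)
          (use k in \<open>simp_all add: g0 gu uniq\<close>)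
    qed
  qed
  \<comment> \<open>Equal matrices for distinct points would make zero a unit, so the clique really
    has \<open>Q^2\<close> elements.\<close>
  have Dinj: "inj_on D {..<Q\<^sup>2}"
  proof (rule inj_onI, rule ccontr)
    fix s t assume st: "s \<in> {..<Q\<^sup>2}" "t \<in> {..<Q\<^sup>2}" "D s = D t" "s \<noteq> t"
    hence "D t - D t \<in> Units (int_mat_ring (n * m))" using Du[of s t] by simp
    hence "0\<^sub>m (n * m) (n * m) \<in> Units (int_mat_ring (n * m))"
      using minus_r_inv_mat[OF Dc[of t]] by simp
    thus False using zero_not_Units_int_mat_ring[of "n * m"] n m by simp
  qed
  have "exceptional_clique (int_mat_ring (n * m)) (D ` {..<Q\<^sup>2})"
    unfolding exceptional_clique_def
  proof (intro conjI ballI impI)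
    show "D ` {..<Q\<^sup>2} \<subseteq> carrier (int_mat_ring (n * m))" using Dc by (auto simp: ring_mat_simps)
    fix u v assume "u \<in> D ` {..<Q\<^sup>2}" "v \<in> D ` {..<Q\<^sup>2}" "u \<noteq> v"
    then obtain s t where "u = D s" "v = D t" "s < Q\<^sup>2" "t < Q\<^sup>2" "s \<noteq> t" by auto
    thus "u \<ominus>\<^bsub>int_mat_ring (n * m)\<^esub> v \<in> Units (int_mat_ring (n * m))"
      using Du Dc by (simp add: a_minus_int_mat_ring)
  qed
  thus ?thesis unfolding has_exceptional_clique_of_size_def m_def[symmetric]
    by (intro exI[of _ "D ` {..<Q\<^sup>2}"]) (simp add: card_image[OF Dinj])
qed

section \<open>Iterated squaring and the growth of the dimension\<close>

lemma primepow_ge_2: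
  fixes q :: nat
  assumes "primepow q"
  shows "q \<ge> 2"
  using primepow_gt_Suc_0[of q] assms by simp

lemma has_exceptional_clique_mono:
  assumes "has_exceptional_clique_of_size R m" "k \<le> m"
  shows "has_exceptional_clique_of_size R k"
proof -
  from assms(1) obtain C where C: "exceptional_clique R C" "finite C" "card C = m"
    by (auto simp: has_exceptional_clique_of_size_def)
  have "k \<le> card C" using C(3) assms(2) by simp
  then obtain D where D: "D \<subseteq> C" "card D = k" "finite D"
    by (rule obtain_subset_with_card_n)
  have "exceptional_clique R D" using C(1) D(1) unfolding exceptional_clique_def by (meson subset_iff)
  with D show ?thesis by (auto simp: has_exceptional_clique_of_size_def)
qed

fun clique_dim :: "nat \<Rightarrow> nat \<Rightarrow> nat \<Rightarrow> nat" where
  "clique_dim d q 0 = d"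
| "clique_dim d q (Suc i) = clique_dim d q i * (q ^ 2 ^ i div 2 + 1)"

lemma clique_dim_pos: "d > 0 \<Longrightarrow> clique_dim d q i > 0"
  by (induction i) auto

lemma has_exceptional_clique_iterate:
  assumes d: "d \<ge> 1" and q: "primepow q"
    and C: "has_exceptional_clique_of_size (int_mat_ring d) q"
  shows "has_exceptional_clique_of_size (int_mat_ring (clique_dim d q i)) (q ^ 2 ^ i)"
proof (induction i)
  case (Suc i)
  let ?Q = "q ^ 2 ^ i"
  have Q: "primepow ?Q"
    using q primepow_gt_0_nat[OF q] by (simp add: primepow_power_iff_nat)
  obtain c :: "nat \<Rightarrow> nat \<Rightarrow> nat" where c: "\<forall>t m. c t m < ?Q"
    "\<forall>s<?Q\<^sup>2. \<forall>t<?Q\<^sup>2. s \<noteq> t \<longrightarrow> (\<exists>!m. m \<le> ?Q \<and> c s m = c t m)"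
    using ex_affine_plane[OF Q] by (elim exE conjE)
  have "q ^ 2 ^ Suc i = ?Q\<^sup>2" by (simp add: power_mult[symmetric] mult.commute)
  moreover have "has_exceptional_clique_of_size (int_mat_ring (clique_dim d q i * (?Q div 2 + 1))) (?Q\<^sup>2)"
    by (rule has_exceptional_clique_square[OF _ primepow_ge_2[OF Q] Suc c(1)[rule_format] c(2)[rule_format]])
      (use clique_dim_pos d in auto)
  ultimately show ?case by simp
qed (use C in simp)

text \<open>Every factor exceeds 1. Hence the stages of the iteration provide infinitely many
  dimensions.\<close>

lemma clique_dim_strict_mono:
  assumes "d \<ge> 1" "q \<ge> 2"
  shows "strict_mono (clique_dim d q)"
  unfolding strict_mono_Suc_iff
proof
  fix i
  have "q ^ 1 \<le> q ^ 2 ^ i" using assms by (intro power_increasing) auto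
  hence "q ^ 2 ^ i div 2 \<ge> 1" using assms by simp
  hence "1 < q ^ 2 ^ i div 2 + 1" by simp
  thus "clique_dim d q i < clique_dim d q (Suc i)"
    using clique_dim_pos[of d q i] assms by simp
qed

text \<open>The origin of \<open>eps\<close>: for a clique of size \<open>x\<close>, the factor
  \<open>x div 2 + 1\<close> equals \<open>x / 2 + 1\<close> for even \<open>x\<close> and
  \<open>(x + 1) / 2\<close> for odd \<open>x\<close>. The product of the sizes
  \<open>q ^ 2 ^ j\<close> over \<open>j < i\<close> is \<open>q ^ (2 ^ i - 1)\<close>, which leaves
  the denominator \<open>q\<close>.\<close>

lemma clique_dim_eq:
  assumes q: "q \<ge> 2"
  shows "real (clique_dim d q i) =
    real d / real q * (real q ^ 2 ^ i / 2 ^ i) * (\<Prod>j<i. 1 + eps q / real q ^ 2 ^ j)"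
proof (induction i)
  case 0
  thus ?case using q by simp
next
  case (Suc i)
  define x where "x = q ^ 2 ^ i"
  have x: "x > 0" using q by (simp add: x_def)
  have "even x \<longleftrightarrow> even q" by (simp add: x_def)
  hence "real (x div 2 + 1) = real x / 2 * (1 + eps q / real x)"
    using x by (cases "even q") (auto simp: eps_def field_simps real_of_nat_div elim!: oddE)
  moreover have xi: "real q ^ 2 ^ i = real x" and "real q ^ 2 ^ Suc i = real x * real x"
    by (simp_all add: x_def mult_2 power_add)
  ultimately show ?case using Suc.IH
    by (simp only: clique_dim.simps x_def[symmetric] of_nat_mult prod.lessThan_Suc)
      (simp add: mult_ac)
qed

section \<open>The limiting constant and the asymptotic bound\<close>

text \<open>The summands are dominated by the geometric series with terms
  \<open>2 / 2 ^ i\<close>.\<close>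

lemma convergent_prod_eps:
  assumes q: "q \<ge> 2"
  shows "convergent_prod (\<lambda>i. 1 + eps q / real q ^ 2 ^ i)"
proof (subst convergent_prod_iff_summable_real)
  show "eps q / real q ^ 2 ^ i > 0" for i using q by (simp add: eps_def)
  show "summable (\<lambda>i. eps q / real q ^ 2 ^ i)"
  proof (rule summable_comparison_test')
    show "summable (\<lambda>i. 2 * (1 / 2 :: real) ^ i)" by (intro summable_mult summable_geometric) simp
    fix i :: nat
    have "(2::real) ^ i \<le> 2 ^ 2 ^ i" by (intro power_increasing) (auto intro: less_imp_le[OF less_exp])
    also have "\<dots> \<le> real q ^ 2 ^ i" using q by (intro power_mono) auto
    finally have "eps q / real q ^ 2 ^ i \<le> 2 / 2 ^ i"
      by (intro frac_le) (auto simp: eps_def)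
    thus "norm (eps q / real q ^ 2 ^ i) \<le> 2 * (1 / 2) ^ i"
      by (simp add: eps_def power_divide)
  qed
qed

lemma clique_const_dim_le:
  assumes d: "d \<ge> 1" and q: "q \<ge> 2"
  shows "eventually (\<lambda>i. clique_const d q * (real (clique_dim d q i) * ln (real (clique_dim d q i)))
    \<le> real (q ^ 2 ^ i)) sequentially"
proof -
  define u where "u i = 1 + eps q / real q ^ 2 ^ i" for i
  define P where "P = prodinf u"
  have cu: "convergent_prod u" unfolding u_def by (rule convergent_prod_eps[OF q])
  have u1: "u i \<ge> 1" for i by (simp add: u_def eps_def)
  hence u0: "u i > 0" for i by (rule order_less_le_trans[rotated]) simp
  have PP: "prod u {..<i} \<le> P" for i unfolding P_def
    using cu u1 by (intro prod_le_prodinf[of _ "prodinf u"]) (auto intro: less_imp_le u0)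
  have prod0: "prod u {..<i} > 0" for i by (intro prod_pos ballI u0)
  have P0: "P > 0" using PP[of 0] by simp
  have cc: "clique_const d q = real q / (real d * ln (real q)) / P"
    unfolding clique_const_def P_def prodinf_inverse[OF cu, unfolded u_def] 
    by (simp add: u_def[abs_def] divide_inverse)
  have lq: "ln (real q) > 0" using q by simp
  \<comment> \<open>Beyond this threshold the dimension is at most the clique size, which bounds its
    logarithm by \<open>2 ^ i * ln q\<close>.\<close>
  have "eventually (\<lambda>i. (2::real) ^ i \<ge> real d * P) sequentially"
    by real_asymp
  thus ?thesis
  proof eventually_elim
    case (elim i)
    let ?n = "real (clique_dim d q i)" and ?Q = "real q ^ 2 ^ i"
    have n: "?n = real d / real q * (?Q / 2 ^ i) * prod u {..<i}"
      unfolding u_def by (rule clique_dim_eq[OF q])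
    have n0: "?n > 0" using clique_dim_pos[of d q i] d by simp
    have Q0: "?Q > 0" using q by simp
    have "real d * prod u {..<i} \<le> real d * P" by (intro mult_left_mono PP) simp
    also have "\<dots> \<le> 2 ^ i" by (rule elim)
    also have "\<dots> \<le> real q * 2 ^ i" using q by simp
    finally have "?n \<le> ?Q" using q Q0 unfolding n by (simp add: field_simps)
    hence "ln ?n \<le> ln ?Q" using n0 Q0 by simp
    hence ln: "ln ?n \<le> 2 ^ i * ln (real q)" using q by (simp add: ln_realpow)
    have "clique_const d q * ?n = ?Q / (2 ^ i * ln (real q)) * (prod u {..<i} / P)"
      unfolding cc n using q d lq P0 by (simp add: field_simps)
    also have "\<dots> \<le> ?Q / (2 ^ i * ln (real q)) * 1"
      using PP P0 lq Q0 by (intro mult_left_mono) auto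
    finally have 1: "clique_const d q * ?n \<le> ?Q / (2 ^ i * ln (real q))" by simp
    have "clique_const d q * ?n * ln ?n \<le> ?Q / (2 ^ i * ln (real q)) * (2 ^ i * ln (real q))"
    proof (rule mult_mono[OF 1 ln])
      show "0 \<le> ln ?n" using n0 by simp
    qed (use lq Q0 in auto)
    also have "\<dots> = ?Q" using lq by simp
    finally show ?case by (simp add: mult.assoc)
  qed
qed

theorem theorem7p5:
  fixes d q :: nat
  assumes "d \<ge> 1"
    and "primepow q"
    and "has_exceptional_clique_of_size (int_mat_ring d) q"
  shows "\<exists>s :: nat \<Rightarrow> nat.
    (\<lambda>n. real (s n) - clique_const d q * (real n * ln (real n)))
        \<in> O(\<lambda>n. real n * ln (ln (real n))) \<and>
    infinite {n. has_exceptional_clique_of_size (int_mat_ring n) (s n)}"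
proof -
  have q: "q \<ge> 2" using assms(2) by (rule primepow_ge_2)
  define f where "f n = clique_const d q * (real n * ln (real n))" for n
  \<comment> \<open>The constructed cliques are at least this large, so they can be shrunk to this size.\<close>
  define s where "s n = nat \<lfloor>f n\<rfloor>" for n
  \<comment> \<open>Nonnegativity of the constant makes \<open>f\<close> nonnegative, so that
    \<open>nat\<close> does not truncate the floor.\<close>
  have "prodinf (\<lambda>i. inverse (1 + eps q / real q ^ 2 ^ i)) = inverse (prodinf (\<lambda>i. 1 + eps q / real q ^ 2 ^ i))"
    by (rule prodinf_inverse[OF convergent_prod_eps[OF q]])
  moreover have "prodinf (\<lambda>i. 1 + eps q / real q ^ 2 ^ i) \<ge> 1"
    using convergent_prod_eps[OF q]
    by (intro prodinf_nonneg[of _ "prodinf (\<lambda>i. 1 + eps q / real q ^ 2 ^ i)"]) (auto simp: eps_def)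
  ultimately have "clique_const d q \<ge> 0" using q by (simp add: clique_const_def)
  hence f0: "f n \<ge> 0" for n unfolding f_def by (cases "n = 0") auto
  \<comment> \<open>Rounding down costs less than 1, well within the allowed error.\<close>
  have "(\<lambda>n. real (s n) - f n) \<in> O(\<lambda>_. 1 :: real)"
  proof (rule bigoI[of _ 1], rule always_eventually, rule allI)
    fix n
    have "real (s n) = of_int \<lfloor>f n\<rfloor>" using f0 by (simp add: s_def)
    thus "norm (real (s n) - f n) \<le> 1 * norm (1 :: real)" by simp linarith
  qed
  also have "(\<lambda>_. 1 :: real) \<in> O(\<lambda>n. real n * ln (ln (real n)))" by real_asymp
  finally have bigo: "(\<lambda>n. real (s n) - f n) \<in> O(\<lambda>n. real n * ln (ln (real n)))" .
  from clique_const_dim_le[OF assms(1) q] obtain i0 where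
    i0: "\<And>i. i \<ge> i0 \<Longrightarrow> f (clique_dim d q i) \<le> real (q ^ 2 ^ i)"
    unfolding f_def eventually_sequentially by blast
  have "has_exceptional_clique_of_size (int_mat_ring (clique_dim d q i)) (s (clique_dim d q i))"
    if "i \<ge> i0" for i
  proof (rule has_exceptional_clique_mono[OF has_exceptional_clique_iterate[OF assms]])
    show "s (clique_dim d q i) \<le> q ^ 2 ^ i" using i0[OF that] f0 unfolding s_def
      by (metis floor_mono floor_of_nat nat_int nat_mono)
  qed
  hence "clique_dim d q ` {i0..} \<subseteq> {n. has_exceptional_clique_of_size (int_mat_ring n) (s n)}"
    by auto
  moreover have "infinite (clique_dim d q ` {i0..})"
    using strict_mono_imp_inj_on[OF clique_dim_strict_mono[OF assms(1) q]]
    by (auto dest!: finite_imageD intro: inj_on_subset simp: infinite_Ici)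
  ultimately have "infinite {n. has_exceptional_clique_of_size (int_mat_ring n) (s n)}"
    by (rule infinite_super)
  with bigo show ?thesis unfolding f_def by blast
qed

end
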